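(* Let $K$ be a compact convex set and let $\Delta$ be a Choquet simplex. Assume there exists an affine surjection $\varphi\colon\Delta\to K$ with an affine cross section $\lambda\colon K\to\Delta$, i.e. $\varphi\circ\lambda=\mathrm{id}_K$ (neither $\varphi$ nor $\lambda$ is required to be continuous). Then $K$ is a Choquet simplex.
   Context: Compact convex sets are compact convex subsets of locally convex topological vector spaces. A map between convex sets is affine if it preserves convex combinations. Choquet simplex: let $K$ be a compact convex subset of a locally convex topological vector space. A (Borel) probability measure $\mu$ on $K$ is a boundary measure if it is maximal in the sense that whenever $\nu$ is a probability measure on $K$ with $\mu(f)\le\nu(f)$ for all continuous convex functions $f\colon K\to\mathbb{R}$, then $\nu=\mu$. The barycenter of $\mu$ is $\int_K x\,d\mu(x)\in K$. $K$ is a Choquet simplex if it satisfies the following conditions, which are classically known to be equivalent: (1) each point of $K$ is the barycenter of a unique boundary measure on $K$; (2) the ordered vector space $\mathrm{Aff}(K)^*$ is a lattice, where $\mathrm{Aff}(K)$ is the space of continuous affine functions $K\to\mathbb{R}$ with the pointwise order, and $\mathrm{Aff}(K)^*$ carries the dual order; (3) (Riesz decomposition property) whenever $x=\sum_{j=1}^n\alpha_jx_j=\sum_{i=1}^m\beta_iy_i$ with $x_j,y_i\in K$, $\alpha_j,\beta_i>0$ and $\sum_j\alpha_j=\sum_i\beta_i=1$, there exist $z_{ij}\in K$ and $\gamma_{ij}\ge 0$ ($1\le j\le n$, $1\le i\le m$) with $\sum_{i,j}\gamma_{ij}=1$, $x=\sum_{i,j}\gamma_{ij}z_{ij}$, and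 $\alpha_j=\sum_{i=1}^m\gamma_{ij}$, $\beta_i=\sum_{j=1}^n\gamma_{ij}$, $x_j=\sum_{i=1}^m\alpha_j^{-1}\gamma_{ij}z_{ij}$, $y_i=\sum_{j=1}^n\beta_i^{-1}\gamma_{ij}z_{ij}$ for all $i,j$. The empty set is regarded as a Choquet simplex. *)

theory Defs
  imports "HOL-Analysis.Analysis"
begin

text \<open>
  Hausdorffness is not part of the class. Hausdorff spaces, the usual setting of Choquet theory,
  are the types that are additionally of class \<^class>\<open>t2_space\<close>.
\<close>

class locally_convex_space = real_vector + topological_ab_group_add +
  assumes tendsto_scaleR_nhds_Pair:
    "LIM p (nhds (a::real) \<times>\<^sub>F nhds x). fst p *\<^sub>R snd p :> nhds (a *\<^sub>R x)"
  assumes convex_nhds_0_basis: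
    "open U \<Longrightarrow> 0 \<in> U \<Longrightarrow>
      \<exists>V. open V \<and> 0 \<in> V \<and> V \<subseteq> U \<and>
        (\<forall>x\<in>V. \<forall>y\<in>V. \<forall>u\<ge>0. \<forall>v\<ge>0. u + v = 1 \<longrightarrow> u *\<^sub>R x + v *\<^sub>R y \<in> V)"

instance real_normed_vector \<subseteq> locally_convex_space
proof
  fix a :: real and x :: 'a
  show "LIM p (nhds a \<times>\<^sub>F nhds x). fst p *\<^sub>R snd p :> nhds (a *\<^sub>R x)"
    by (intro tendsto_scaleR filterlim_fst filterlim_snd)
next
  fix U :: "'a set"
  assume "open U" "0 \<in> U"
  then obtain e where e: "e > 0" "ball 0 e \<subseteq> U"
    by (meson openE)
  then have "\<forall>x\<in>ball 0 e. \<forall>y\<in>ball 0 e. \<forall>u\<ge>0. \<forall>v\<ge>0. u + v = 1 \<longrightarrow>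
      u *\<^sub>R x + v *\<^sub>R y \<in> ball (0::'a) e"
    using convex_ball[of "0::'a" e] unfolding convex_def by blast
  with e show "\<exists>V. open V \<and> 0 \<in> V \<and> V \<subseteq> U \<and>
        (\<forall>x\<in>V. \<forall>y\<in>V. \<forall>u\<ge>0. \<forall>v\<ge>0. u + v = 1 \<longrightarrow> u *\<^sub>R x + v *\<^sub>R y \<in> V)"
    by (intro exI[of _ "ball 0 e"]) auto
qed

text \<open>
  Binary convex combinations, as in \<^const>\<open>convex\<close> and \<^const>\<open>convex_on\<close>. On a convex set this
  implies the finite version by induction.
\<close>

definition affine_on :: "'a::real_vector set \<Rightarrow> ('a \<Rightarrow> 'b::real_vector) \<Rightarrow> bool" where
  "affine_on S f \<longleftrightarrow>
    (\<forall>x\<in>S. \<forall>y\<in>S. \<forall>u\<ge>0. \<forall>v\<ge>0. u + v = 1 \<longrightarrow> f (u *\<^sub>R x + v *\<^sub>R y) = u *\<^sub>R f x + v *\<^sub>R f y)"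

definition riesz_decomposition :: "'a::real_vector set \<Rightarrow> bool" where
  "riesz_decomposition K \<longleftrightarrow>
    (\<forall>(x::'a) (n::nat) (m::nat) (\<alpha>::nat \<Rightarrow> real) (\<beta>::nat \<Rightarrow> real) (X::nat \<Rightarrow> 'a) (Y::nat \<Rightarrow> 'a).
      (\<forall>j\<in>{1..n}. X j \<in> K \<and> \<alpha> j > 0) \<and>
      (\<forall>i\<in>{1..m}. Y i \<in> K \<and> \<beta> i > 0) \<and>
      (\<Sum>j=1..n. \<alpha> j) = 1 \<and> (\<Sum>i=1..m. \<beta> i) = 1 \<and>
      x = (\<Sum>j=1..n. \<alpha> j *\<^sub>R X j) \<and> x = (\<Sum>i=1..m. \<beta> i *\<^sub>R Y i)
      \<longrightarrow>
      (\<exists>(z::nat \<Rightarrow> nat \<Rightarrow> 'a) (\<gamma>::nat \<Rightarrow> nat \<Rightarrow> real).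
        (\<forall>i\<in>{1..m}. \<forall>j\<in>{1..n}. z i j \<in> K \<and> \<gamma> i j \<ge> 0) \<and>
        (\<Sum>i=1..m. \<Sum>j=1..n. \<gamma> i j) = 1 \<and>
        x = (\<Sum>i=1..m. \<Sum>j=1..n. \<gamma> i j *\<^sub>R z i j) \<and>
        (\<forall>j\<in>{1..n}. \<alpha> j = (\<Sum>i=1..m. \<gamma> i j) \<and>
           X j = (\<Sum>i=1..m. (inverse (\<alpha> j) * \<gamma> i j) *\<^sub>R z i j)) \<and>
        (\<forall>i\<in>{1..m}. \<beta> i = (\<Sum>j=1..n. \<gamma> i j) \<and>
           Y i = (\<Sum>j=1..n. (inverse (\<beta> i) * \<gamma> i j) *\<^sub>R z i j))))"

text \<open>
  Of the classically equivalent defining conditions of a Choquet simplex (unique representing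
  boundary measures, lattice order on the dual of the continuous affine functions, Riesz
  decomposition), the last one is used. The empty set is a Choquet simplex.
\<close>

definition choquet_simplex :: "'a::locally_convex_space set \<Rightarrow> bool" where
  "choquet_simplex K \<longleftrightarrow> compact K \<and> convex K \<and> riesz_decomposition K"

end

theory Submission
  imports Defs
begin

text \<open>The Riesz decomposition property is purely algebraic: it speaks only of finite convex
  combinations, so it can be transported by affine maps that are not continuous. Given two
  representations of a point \<open>x\<close> of \<open>K\<close>, the section
  \<open>\<sigma>\<close> lifts them to two representations of \<open>\<sigma> x\<close> in
  \<open>\<Delta>\<close> with the same coefficients. A common refinement exists there, with weights
  \<open>\<gamma>\<close> and points \<open>z\<close>; applying \<open>\<phi>\<close> to the points,
  keeping the weights and using that \<open>\<phi>\<close> undoes \<open>\<sigma>\<close> on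
  \<open>K\<close> gives a refinement in \<open>K\<close>. The transport is
  \<open>riesz_decomposition_affine_retract\<close>; it rests on \<open>affine_on_sum\<close>, which
  extends affinity from two points to finitely many.\<close>

lemma affine_on_sum:
  fixes f :: "'a::real_vector \<Rightarrow> 'b::real_vector"
  assumes f: "affine_on S f" and S: "convex S" and I: "finite I"
    and "(\<Sum>i\<in>I. a i) = 1" "\<And>i. i \<in> I \<Longrightarrow> a i \<ge> 0" "\<And>i. i \<in> I \<Longrightarrow> X i \<in> S"
  shows "f (\<Sum>i\<in>I. a i *\<^sub>R X i) = (\<Sum>i\<in>I. a i *\<^sub>R f (X i))"
  using I assms(4-6)
proof (induction I arbitrary: a rule: finite_induct)
  case empty
  then show ?case by simp
next
  case (insert i I)
  define s where "s = (\<Sum>j\<in>I. a j)"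
  have s: "a i + s = 1" and s0: "s \<ge> 0"
    using insert by (auto simp: s_def intro: sum_nonneg)
  show ?case
  \<comment> \<open>If the remaining weights sum to 0, they cannot be renormalised; but then they
    all vanish and \<open>a i\<close> is 1.\<close>
  proof (cases "s = 0")
    case True
    then have "\<forall>j\<in>I. a j = 0"
      using insert by (simp add: s_def sum_nonneg_eq_0_iff)
    then show ?thesis
      using s True insert.hyps by simp
  next
    case False
    \<comment> \<open>The renormalised tail is itself a convex combination, so its value
      \<open>?y\<close> lies in \<open>S\<close> and the sum becomes a binary combination of
      \<open>X i\<close> and \<open>?y\<close>.\<close>
    define b where "b j = a j / s" for j
    have b: "(\<Sum>j\<in>I. b j) = 1" "\<And>j. j \<in> I \<Longrightarrow> b j \<ge> 0"
      using False s0 insert.prems by (auto simp: b_def s_def simp flip: sum_divide_distrib)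
    have ab: "a j = s * b j" for j
      using False by (simp add: b_def)
    let ?y = "\<Sum>j\<in>I. b j *\<^sub>R X j"
    have y: "?y \<in> S"
      using S insert.hyps b insert.prems by (intro convex_sum) auto
    have "f (\<Sum>j\<in>insert i I. a j *\<^sub>R X j) = f (a i *\<^sub>R X i + s *\<^sub>R ?y)"
      using insert.hyps ab by (simp add: scaleR_sum_right)
    also have "\<dots> = a i *\<^sub>R f (X i) + s *\<^sub>R f ?y"
      using f y s s0 insert.prems unfolding affine_on_def by blast
    also have "f ?y = (\<Sum>j\<in>I. b j *\<^sub>R f (X j))"
      using insert.IH b insert.prems by simp
    finally show ?thesis
      using insert.hyps ab by (simp add: scaleR_sum_right)
  qed
qed

text \<open>Decompose in \<open>\<Delta>\<close> after lifting by \<open>\<sigma>\<close>, then push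
  the refining points down by \<open>\<phi>\<close>. The setting is real vector spaces without
  topology, since only convexity and affinity enter.\<close>

lemma riesz_decomposition_affine_retract:
  fixes \<phi> :: "'b::real_vector \<Rightarrow> 'a::real_vector" and \<sigma> :: "'a \<Rightarrow> 'b"
  assumes K: "convex K" and \<Delta>: "convex \<Delta>" "riesz_decomposition \<Delta>"
    and \<phi>: "affine_on \<Delta> \<phi>" "\<phi> ` \<Delta> \<subseteq> K"
    and \<sigma>: "affine_on K \<sigma>" "\<sigma> ` K \<subseteq> \<Delta>"
    and \<phi>\<sigma>: "\<forall>x\<in>K. \<phi> (\<sigma> x) = x"
  shows "riesz_decomposition K"
  unfolding riesz_decomposition_def
proof (intro allI impI, elim conjE)
  fix x n m and \<alpha> \<beta> :: "nat \<Rightarrow> real" and X Y :: "nat \<Rightarrow> 'a"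
  assume X: "\<forall>j\<in>{1..n}. X j \<in> K \<and> \<alpha> j > 0" and Y: "\<forall>i\<in>{1..m}. Y i \<in> K \<and> \<beta> i > 0"
    and \<alpha>: "(\<Sum>j=1..n. \<alpha> j) = 1" and \<beta>: "(\<Sum>i=1..m. \<beta> i) = 1"
    and xX: "x = (\<Sum>j=1..n. \<alpha> j *\<^sub>R X j)" and xY: "x = (\<Sum>i=1..m. \<beta> i *\<^sub>R Y i)"
  have \<sigma>X: "\<sigma> x = (\<Sum>j=1..n. \<alpha> j *\<^sub>R \<sigma> (X j))"
    unfolding xX using X \<alpha> by (intro affine_on_sum[OF \<sigma>(1) K]) (auto simp: less_imp_le)
  have \<sigma>Y: "\<sigma> x = (\<Sum>i=1..m. \<beta> i *\<^sub>R \<sigma> (Y i))"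
    unfolding xY using Y \<beta> by (intro affine_on_sum[OF \<sigma>(1) K]) (auto simp: less_imp_le)
  \<comment> \<open>Lifting moves the points but not the coefficients, so the matrix
    \<open>\<gamma>\<close> found in \<open>\<Delta>\<close> already has the row and column sums
    wanted in \<open>K\<close>.\<close>
  have "(\<forall>j\<in>{1..n}. \<sigma> (X j) \<in> \<Delta> \<and> \<alpha> j > 0) \<and> (\<forall>i\<in>{1..m}. \<sigma> (Y i) \<in> \<Delta> \<and> \<beta> i > 0)"
    using X Y \<sigma>(2) by blast
  then obtain z \<gamma> where z: "\<forall>i\<in>{1..m}. \<forall>j\<in>{1..n}. z i j \<in> \<Delta> \<and> \<gamma> i j \<ge> 0"
    and \<gamma>: "(\<Sum>i=1..m. \<Sum>j=1..n. \<gamma> i j) = 1"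
    and Xz: "\<forall>j\<in>{1..n}. \<alpha> j = (\<Sum>i=1..m. \<gamma> i j) \<and>
           \<sigma> (X j) = (\<Sum>i=1..m. (inverse (\<alpha> j) * \<gamma> i j) *\<^sub>R z i j)"
    and Yz: "\<forall>i\<in>{1..m}. \<beta> i = (\<Sum>j=1..n. \<gamma> i j) \<and>
           \<sigma> (Y i) = (\<Sum>j=1..n. (inverse (\<beta> i) * \<gamma> i j) *\<^sub>R z i j)"
    using \<Delta>(2)[unfolded riesz_decomposition_def, rule_format,
        of n "\<lambda>j. \<sigma> (X j)" \<alpha> m "\<lambda>i. \<sigma> (Y i)" \<beta> "\<sigma> x"] \<alpha> \<beta> \<sigma>X \<sigma>Y
    by blast
  \<comment> \<open>Apply \<open>\<phi>\<close> to the decomposition of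
    \<open>\<sigma> (X j)\<close>. The weights are those of a convex combination because the
    \<open>\<gamma> i j\<close> with \<open>j\<close> fixed sum to \<open>\<alpha> j\<close>, which
    is positive.\<close>
  have X': "X j = (\<Sum>i=1..m. (inverse (\<alpha> j) * \<gamma> i j) *\<^sub>R \<phi> (z i j))" if j: "j \<in> {1..n}" for j
  proof -
    have "X j = \<phi> (\<Sum>i=1..m. (inverse (\<alpha> j) * \<gamma> i j) *\<^sub>R z i j)"
      using X Xz \<phi>\<sigma> j by metis
    also have "\<dots> = (\<Sum>i=1..m. (inverse (\<alpha> j) * \<gamma> i j) *\<^sub>R \<phi> (z i j))"
    proof (rule affine_on_sum[OF \<phi>(1) \<Delta>(1)])
      have "\<alpha> j > 0" "(\<Sum>i=1..m. \<gamma> i j) = \<alpha> j"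
        using X Xz j by simp_all
      then show "(\<Sum>i=1..m. inverse (\<alpha> j) * \<gamma> i j) = 1"
        by (simp flip: sum_distrib_left)
    qed (use X z j in \<open>auto simp: less_imp_le\<close>)
    finally show ?thesis .
  qed
  have Y': "Y i = (\<Sum>j=1..n. (inverse (\<beta> i) * \<gamma> i j) *\<^sub>R \<phi> (z i j))" if i: "i \<in> {1..m}" for i
  proof -
    have "Y i = \<phi> (\<Sum>j=1..n. (inverse (\<beta> i) * \<gamma> i j) *\<^sub>R z i j)"
      using Y Yz \<phi>\<sigma> i by metis
    also have "\<dots> = (\<Sum>j=1..n. (inverse (\<beta> i) * \<gamma> i j) *\<^sub>R \<phi> (z i j))"
    proof (rule affine_on_sum[OF \<phi>(1) \<Delta>(1)])
      have "\<beta> i > 0" "(\<Sum>j=1..n. \<gamma> i j) = \<beta> i"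
        using Y Yz i by simp_all
      then show "(\<Sum>j=1..n. inverse (\<beta> i) * \<gamma> i j) = 1"
        by (simp flip: sum_distrib_left)
    qed (use Y z i in \<open>auto simp: less_imp_le\<close>)
    finally show ?thesis .
  qed
  \<comment> \<open>Multiplying \<open>Y'\<close> by \<open>\<beta> i\<close> cancels the inverse;
    summing over \<open>i\<close> then turns the second representation of \<open>x\<close> into the
    required double sum.\<close>
  have "\<beta> i *\<^sub>R Y i = (\<Sum>j=1..n. \<gamma> i j *\<^sub>R \<phi> (z i j))" if i: "i \<in> {1..m}" for i
  proof -
    have "\<beta> i \<noteq> 0"
      using Y i by force
    then show ?thesis
      by (subst Y'[OF i]) (simp add: scaleR_sum_right flip: mult.assoc)
  qed
  then have "x = (\<Sum>i=1..m. \<Sum>j=1..n. \<gamma> i j *\<^sub>R \<phi> (z i j))"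
    unfolding xY by (intro sum.cong) auto
  moreover have "\<forall>i\<in>{1..m}. \<forall>j\<in>{1..n}. \<phi> (z i j) \<in> K \<and> \<gamma> i j \<ge> 0"
    using z \<phi>(2) by blast
  moreover have "\<forall>j\<in>{1..n}. \<alpha> j = (\<Sum>i=1..m. \<gamma> i j) \<and>
           X j = (\<Sum>i=1..m. (inverse (\<alpha> j) * \<gamma> i j) *\<^sub>R \<phi> (z i j))"
    using X' Xz by blast
  moreover have "\<forall>i\<in>{1..m}. \<beta> i = (\<Sum>j=1..n. \<gamma> i j) \<and>
           Y i = (\<Sum>j=1..n. (inverse (\<beta> i) * \<gamma> i j) *\<^sub>R \<phi> (z i j))"
    using Y' Yz by blast
  ultimately show "\<exists>z \<gamma>. (\<forall>i\<in>{1..m}. \<forall>j\<in>{1..n}. z i j \<in> K \<and> \<gamma> i j \<ge> 0) \<and>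
        (\<Sum>i=1..m. \<Sum>j=1..n. \<gamma> i j) = 1 \<and>
        x = (\<Sum>i=1..m. \<Sum>j=1..n. \<gamma> i j *\<^sub>R z i j) \<and>
        (\<forall>j\<in>{1..n}. \<alpha> j = (\<Sum>i=1..m. \<gamma> i j) \<and>
           X j = (\<Sum>i=1..m. (inverse (\<alpha> j) * \<gamma> i j) *\<^sub>R z i j)) \<and>
        (\<forall>i\<in>{1..m}. \<beta> i = (\<Sum>j=1..n. \<gamma> i j) \<and>
           Y i = (\<Sum>j=1..n. (inverse (\<beta> i) * \<gamma> i j) *\<^sub>R z i j))"
    using \<gamma> by (intro exI[of _ "\<lambda>i j. \<phi> (z i j)"] exI[of _ \<gamma>] conjI)
qed

theorem proposition2p5:
  fixes K :: "'a::locally_convex_space set"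
    and \<Delta> :: "'b::locally_convex_space set"
    and \<phi> :: "'b \<Rightarrow> 'a"
    and \<sigma> :: "'a \<Rightarrow> 'b"
  assumes "compact K" and "convex K"
    and "choquet_simplex \<Delta>"
    and "affine_on \<Delta> \<phi>" and "\<phi> ` \<Delta> = K"
    and "affine_on K \<sigma>" and "\<sigma> ` K \<subseteq> \<Delta>"
    and "\<forall>x\<in>K. \<phi> (\<sigma> x) = x"
  shows "choquet_simplex K"
  \<comment> \<open>Compactness and convexity of \<open>K\<close> are given, so only the Riesz
    decomposition property has to be transferred from \<open>\<Delta>\<close>.\<close>
  using assms riesz_decomposition_affine_retract[of K \<Delta> \<phi> \<sigma>]
  by (simp add: choquet_simplex_def)

end
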